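(* Let $r\geq 2$ and let $(P,\mathcal{L})$ be an $r$-uniform linear system with $|\mathcal{L}|>\nu_2(P,\mathcal{L})$. If $\nu_2(P,\mathcal{L})=4$, then $$\tau(P,\mathcal{L})\leq \frac{|P|+|\mathcal{L}|}{r+1}.$$
   Context: A linear system is a pair $(P,\mathcal{L})$ where $P$ is a finite set (points) and $\mathcal{L}$ is a family of subsets of $P$ (lines) such that $|l\cap l'|\leq 1$ for all distinct $l,l'\in\mathcal{L}$. It is $r$-uniform if every line has exactly $r$ points. A transversal is a set $T\subseteq P$ meeting every line; $\tau(P,\mathcal{L})$ is the minimum size of a transversal. A 2-packing is a set $R\subseteq\mathcal{L}$ of lines such that no three lines of $R$ have a common point; $\nu_2(P,\mathcal{L})$ is the maximum size of a 2-packing. *)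

theory Defs
  imports Complex_Main
begin

definition linear_system :: "'a set \<Rightarrow> 'a set set \<Rightarrow> bool" where
  "linear_system P L \<longleftrightarrow>
     finite P \<and> (\<forall>l\<in>L. l \<subseteq> P) \<and> (\<forall>l\<in>L. \<forall>l'\<in>L. l \<noteq> l' \<longrightarrow> card (l \<inter> l') \<le> 1)"

definition uniform_system :: "nat \<Rightarrow> 'a set set \<Rightarrow> bool" where
  "uniform_system r L \<longleftrightarrow> (\<forall>l\<in>L. card l = r)"

definition transversal :: "'a set \<Rightarrow> 'a set set \<Rightarrow> 'a set \<Rightarrow> bool" where
  "transversal P L T \<longleftrightarrow> T \<subseteq> P \<and> (\<forall>l\<in>L. T \<inter> l \<noteq> {})"

text \<open>For finite \<open>P\<close> the set under \<open>Min\<close> is finite; it is nonempty as soon as no line is empty,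
  since then \<open>P\<close> itself is a transversal.\<close>

definition transversal_number :: "'a set \<Rightarrow> 'a set set \<Rightarrow> nat" where
  "transversal_number P L = Min {card T |T. transversal P L T}"

definition two_packing :: "'a set \<Rightarrow> 'a set set \<Rightarrow> 'a set set \<Rightarrow> bool" where
  "two_packing P L R \<longleftrightarrow> R \<subseteq> L \<and>
     (\<forall>a\<in>R. \<forall>b\<in>R. \<forall>c\<in>R. a \<noteq> b \<and> a \<noteq> c \<and> b \<noteq> c \<longrightarrow> \<not> (\<exists>p\<in>P. p \<in> a \<and> p \<in> b \<and> p \<in> c))"

definition two_packing_number :: "'a set \<Rightarrow> 'a set set \<Rightarrow> nat" where
  "two_packing_number P L = Max {card R |R. two_packing P L R}"

end

theory Submission
  imports Defs
begin

text \<open>Fix a maximum 2-packing \<open>a, b, c, d\<close>. By maximality every other line passes through an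
  intersection point of two of these lines, and hence belongs to one of six classes \<open>E\<close> (one such
  point) or three classes \<open>F\<close> (two opposite points). Lines of two \<open>E\<close> classes that share an index,
  such as \<open>ab\<close> and \<open>ac\<close>, meet on the remaining line \<open>d\<close>, since otherwise they would form with
  \<open>b, c, d\<close> a 2-packing of size five. These concurrences always give a transversal of size 4.
  Counting yields \<open>|P| + |L| \<ge> 4 r + 4 + m + o - k\<close>, where \<open>m\<close> is the number of nonempty classes,
  \<open>k\<close> the number of intersecting pairs among \<open>a, b, c, d\<close> and \<open>o\<close> the number of points off these
  lines, to which a line of an \<open>F\<close> class contributes \<open>r - 2\<close>. Going through the possible sets of
  nonempty \<open>E\<close> classes, viewed as graphs on \<open>{a, b, c, d}\<close>, either this bound reaches
  \<open>4 r + 4\<close> or three points meet all lines. The same bound gives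
  \<open>|P| + |L| \<ge> 3 r + 3\<close> unless there is a single nonempty class, of type \<open>E\<close>, and the four lines
  meet pairwise; then two points meet all lines.\<close>

section \<open>Concurrence of lines and the combinatorial setting\<close>

text \<open>Unlike in \<open>two_packing\<close>, the common point ranges over the whole type; for
  lines, which are subsets of \<open>P\<close>, the two readings agree.\<close>

definition conc :: "'a set \<Rightarrow> 'a set \<Rightarrow> 'a set \<Rightarrow> bool" where
  "conc x y z \<longleftrightarrow> (\<exists>p. p \<in> x \<and> p \<in> y \<and> p \<in> z)"

text \<open>Valued 0 or 1 so that the intersecting pairs among four lines can be counted by a
  sum.\<close>

definition meets :: "'a set \<Rightarrow> 'a set \<Rightarrow> nat" where
  "meets x y = of_bool (x \<inter> y \<noteq> {})"

lemma meets_commute: "meets x y = meets y x"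
  by (simp add: meets_def Int_commute)

lemma meets_le_1: "meets x y \<le> 1"
  by (simp add: meets_def)

lemma meets_eq_1: "p \<in> x \<Longrightarrow> p \<in> y \<Longrightarrow> meets x y = 1"
  by (auto simp: meets_def)

lemma conc_swap: "conc x y z = conc y x z" "conc x y z = conc x z y"
  by (auto simp: conc_def)

lemmas conc_commute = conc_swap(1)

text \<open>The hypotheses in elementwise form: \<open>linear\<close> says that two lines share at
  most one point, \<open>five_lines\<close> that no five lines form a 2-packing. A 2-packing of size
  four is supplied separately by \<open>quad\<close>.\<close>

locale packing4_system =
  fixes P :: "'a set" and L :: "'a set set" and r :: nat
  assumes finite_P: "finite P"
    and line_subset: "l \<in> L \<Longrightarrow> l \<subseteq> P"
    and linear: "\<lbrakk>l \<in> L; l' \<in> L; l \<noteq> l'; p \<in> l; p \<in> l'; q \<in> l; q \<in> l'\<rbrakk> \<Longrightarrow> p = q"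
    and uniform: "l \<in> L \<Longrightarrow> card l = r"
    and r_ge_2: "2 \<le> r"
    and card_L: "5 \<le> card L"
    and five_lines: "\<lbrakk>{u, v, w, x, y} \<subseteq> L; distinct [u, v, w, x, y]\<rbrakk> \<Longrightarrow>
      conc u v w \<or> conc u v x \<or> conc u v y \<or> conc u w x \<or> conc u w y \<or> conc u x y \<or>
      conc v w x \<or> conc v w y \<or> conc v x y \<or> conc w x y"
begin

section \<open>Classes of lines relative to a 2-packing of four lines\<close>

definition quad :: "'a set \<Rightarrow> 'a set \<Rightarrow> 'a set \<Rightarrow> 'a set \<Rightarrow> bool" where
  "quad a b c d \<longleftrightarrow> {a, b, c, d} \<subseteq> L \<and> distinct [a, b, c, d] \<and>
     \<not> conc a b c \<and> \<not> conc a b d \<and> \<not> conc a c d \<and> \<not> conc b c d"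

definition E :: "'a set \<Rightarrow> 'a set \<Rightarrow> 'a set \<Rightarrow> 'a set \<Rightarrow> 'a set set" where
  "E a b c d = {l \<in> L. l \<noteq> a \<and> l \<noteq> b \<and> conc a b l \<and> \<not> conc c d l}"

definition F :: "'a set \<Rightarrow> 'a set \<Rightarrow> 'a set \<Rightarrow> 'a set \<Rightarrow> 'a set set" where
  "F a b c d = {l \<in> L. l \<notin> {a, b, c, d} \<and> conc a b l \<and> conc c d l}"

text \<open>Bounds the transversal number by \<open>k\<close> without mentioning \<open>Min\<close>.
  Since only \<open>card T \<le> k\<close> is asked, points chosen for a transversal may
  coincide.\<close>

definition hit :: "nat \<Rightarrow> bool" where
  "hit k \<longleftrightarrow> (\<exists>T. T \<subseteq> P \<and> card T \<le> k \<and> (\<forall>l\<in>L. T \<inter> l \<noteq> {}))"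

text \<open>All 24 relabellings in lexicographic order. Later proofs argue for one labelling and
  pick the others by index.\<close>

lemma quad_perms:
  assumes "quad a b c d"
  shows "quad a b c d" "quad a b d c" "quad a c b d" "quad a c d b" "quad a d b c" "quad a d c b"
    "quad b a c d" "quad b a d c" "quad b c a d" "quad b c d a" "quad b d a c" "quad b d c a"
    "quad c a b d" "quad c a d b" "quad c b a d" "quad c b d a" "quad c d a b" "quad c d b a"
    "quad d a b c" "quad d a c b" "quad d b a c" "quad d b c a" "quad d c a b" "quad d c b a"
  using assms by (simp_all add: quad_def conc_swap eq_commute)

lemma E_swap: "E a b c d = E b a c d" "E a b c d = E a b d c"
  by (auto simp: E_def conc_def)

lemma F_swap: "F a b c d = F b a c d" "F a b c d = F a b d c" "F a b c d = F c d a b"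
  by (auto simp: F_def conc_def)

lemmas swaps = E_swap F_swap

lemma finite_L: "finite L"
  using card_L by (metis card.infinite not_numeral_le_zero)

lemma finite_line: "l \<in> L \<Longrightarrow> finite l"
  using line_subset finite_P finite_subset by blast

lemma in_P: "l \<in> L \<Longrightarrow> p \<in> l \<Longrightarrow> p \<in> P"
  using line_subset by blast

lemma line_point:
  assumes "l \<in> L" obtains p where "p \<in> l"
  using uniform[OF assms] r_ge_2 by fastforce

lemma quad_L:
  assumes "quad a b c d"
  shows "a \<in> L" "b \<in> L" "c \<in> L" "d \<in> L" "a \<noteq> b" "a \<noteq> c" "a \<noteq> d" "b \<noteq> c" "b \<noteq> d" "c \<noteq> d"
  using assms by (auto simp: quad_def)

lemma quad_no3:
  assumes "quad a b c d"
  shows "p \<in> a \<Longrightarrow> p \<in> b \<Longrightarrow> p \<notin> c" "p \<in> a \<Longrightarrow> p \<in> b \<Longrightarrow> p \<notin> d"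
    "p \<in> a \<Longrightarrow> p \<in> c \<Longrightarrow> p \<notin> d" "p \<in> b \<Longrightarrow> p \<in> c \<Longrightarrow> p \<notin> d"
  using assms by (auto simp: quad_def conc_def)

text \<open>The two concurrence points would both lie on \<open>a\<close> and \<open>l\<close>,
  hence coincide, and \<open>a\<close>, \<open>b\<close>, \<open>c\<close> would be
  concurrent.\<close>

lemma conc_unique:
  assumes "quad a b c d" "l \<in> L" "l \<noteq> a" "conc a b l" shows "\<not> conc a c l"
proof
  assume "conc a c l"
  then obtain q where q: "q \<in> a" "q \<in> c" "q \<in> l" by (auto simp: conc_def)
  obtain p where p: "p \<in> a" "p \<in> b" "p \<in> l" using assms(4) by (auto simp: conc_def)
  have "p = q" using linear[of a l p q] p q assms quad_L by blast
  then show False using p q quad_no3[OF assms(1)] by blast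
qed

lemma E_props:
  assumes "quad a b c d" "l \<in> E a b c d"
  shows "l \<in> L" "l \<noteq> a" "l \<noteq> b" "l \<noteq> c" "l \<noteq> d" "conc a b l" "\<not> conc c d l"
    "\<not> conc a c l" "\<not> conc a d l" "\<not> conc b c l" "\<not> conc b d l"
proof -
  show *: "l \<in> L" "l \<noteq> a" "l \<noteq> b" "conc a b l" "\<not> conc c d l"
    using assms by (auto simp: E_def)
  show "l \<noteq> c" "l \<noteq> d" using assms by (auto simp: E_def quad_def)
  note q = quad_perms[OF assms(1)]
  show "\<not> conc a c l" "\<not> conc a d l" "\<not> conc b c l" "\<not> conc b d l"
    using conc_unique[OF q(1)] conc_unique[OF q(2)] conc_unique[OF q(7)] conc_unique[OF q(8)] *
    by (auto simp: conc_commute)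
qed

lemma F_props:
  assumes "quad a b c d" "l \<in> F a b c d"
  shows "l \<in> L" "l \<noteq> a" "l \<noteq> b" "l \<noteq> c" "l \<noteq> d" "conc a b l" "conc c d l"
    "\<not> conc a c l" "\<not> conc a d l" "\<not> conc b c l" "\<not> conc b d l"
proof -
  show *: "l \<in> L" "l \<noteq> a" "l \<noteq> b" "l \<noteq> c" "l \<noteq> d" "conc a b l" "conc c d l"
    using assms by (auto simp: F_def)
  note q = quad_perms[OF assms(1)]
  show "\<not> conc a c l" "\<not> conc a d l" "\<not> conc b c l" "\<not> conc b d l"
    using conc_unique[OF q(1)] conc_unique[OF q(2)] conc_unique[OF q(7)] conc_unique[OF q(8)] *
    by (auto simp: conc_commute)
qed

lemma E_hit:
  assumes "quad a b c d" "p \<in> a" "p \<in> b" "l \<in> E a b c d" shows "p \<in> l"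
proof -
  obtain s where "s \<in> a" "s \<in> b" "s \<in> l"
    using E_props(6)[OF assms(1,4)] by (auto simp: conc_def)
  then show ?thesis using linear[of a b p s] quad_L[OF assms(1)] assms(2,3) by blast
qed

lemma F_hit:
  assumes "quad a b c d" "p \<in> a" "p \<in> b" "l \<in> F a b c d" shows "p \<in> l"
proof -
  obtain s where "s \<in> a" "s \<in> b" "s \<in> l"
    using F_props(6)[OF assms(1,4)] by (auto simp: conc_def)
  then show ?thesis using linear[of a b p s] quad_L[OF assms(1)] assms(2,3) by blast
qed

text \<open>Among \<open>a, b, c, d, l\<close> some three concur by \<open>five_lines\<close>. They
  include \<open>l\<close>, so \<open>l\<close> passes through one of the six intersection points;
  whether it also passes through the opposite one decides between \<open>E\<close> and
  \<open>F\<close>.\<close>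

lemma line_cases:
  assumes "quad a b c d" "l \<in> L"
  shows "l \<in> {a, b, c, d} \<union> E a b c d \<union> E a c b d \<union> E a d b c \<union> E b c a d \<union> E b d a c \<union>
    E c d a b \<union> F a b c d \<union> F a c b d \<union> F a d b c"
proof (cases "l \<in> {a, b, c, d}")
  case False
  then have "conc a b l \<or> conc a c l \<or> conc a d l \<or> conc b c l \<or> conc b d l \<or> conc c d l"
    using five_lines[of a b c d l] assms unfolding quad_def by fastforce
  then show ?thesis using False assms by (auto simp: E_def F_def)
qed blast

lemma hitI:
  assumes q: "quad a b c d" and T: "T \<subseteq> P" "card T \<le> k"
    and "\<forall>l \<in> {a, b, c, d}. T \<inter> l \<noteq> {}"
    and "\<forall>l \<in> E a b c d. T \<inter> l \<noteq> {}" "\<forall>l \<in> E a c b d. T \<inter> l \<noteq> {}" "\<forall>l \<in> E a d b c. T \<inter> l \<noteq> {}"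
    and "\<forall>l \<in> E b c a d. T \<inter> l \<noteq> {}" "\<forall>l \<in> E b d a c. T \<inter> l \<noteq> {}" "\<forall>l \<in> E c d a b. T \<inter> l \<noteq> {}"
    and "\<forall>l \<in> F a b c d. T \<inter> l \<noteq> {}" "\<forall>l \<in> F a c b d. T \<inter> l \<noteq> {}" "\<forall>l \<in> F a d b c. T \<inter> l \<noteq> {}"
  shows "hit k"
proof -
  have "T \<inter> l \<noteq> {}" if "l \<in> L" for l
    using line_cases[OF q that] assms(4-) by (elim UnE) (rule bspec, assumption, assumption)+
  then show ?thesis using T by (auto simp: hit_def)
qed

lemma hit3I:
  assumes "quad a b c d" "p \<in> P" "s \<in> P" "t \<in> P"
    and "\<forall>l \<in> {a, b, c, d}. p \<in> l \<or> s \<in> l \<or> t \<in> l"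
    and "\<forall>l \<in> E a b c d. p \<in> l \<or> s \<in> l \<or> t \<in> l" "\<forall>l \<in> E a c b d. p \<in> l \<or> s \<in> l \<or> t \<in> l"
      "\<forall>l \<in> E a d b c. p \<in> l \<or> s \<in> l \<or> t \<in> l" "\<forall>l \<in> E b c a d. p \<in> l \<or> s \<in> l \<or> t \<in> l"
      "\<forall>l \<in> E b d a c. p \<in> l \<or> s \<in> l \<or> t \<in> l" "\<forall>l \<in> E c d a b. p \<in> l \<or> s \<in> l \<or> t \<in> l"
    and "\<forall>l \<in> F a b c d. p \<in> l \<or> s \<in> l \<or> t \<in> l" "\<forall>l \<in> F a c b d. p \<in> l \<or> s \<in> l \<or> t \<in> l"
      "\<forall>l \<in> F a d b c. p \<in> l \<or> s \<in> l \<or> t \<in> l"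
  shows "hit 3"
proof -
  have "{p, s, t} \<inter> l \<noteq> {} \<longleftrightarrow> p \<in> l \<or> s \<in> l \<or> t \<in> l" for l by blast
  then show ?thesis
    using assms by (intro hitI[of a b c d "{p, s, t}"]) (simp_all only:, auto simp: card_insert_if)
qed

lemma hit4I:
  assumes "quad a b c d" "p \<in> P" "s \<in> P" "t \<in> P" "u \<in> P"
    and "\<forall>l \<in> {a, b, c, d}. p \<in> l \<or> s \<in> l \<or> t \<in> l \<or> u \<in> l"
    and "\<forall>l \<in> E a b c d. p \<in> l \<or> s \<in> l \<or> t \<in> l \<or> u \<in> l" "\<forall>l \<in> E a c b d. p \<in> l \<or> s \<in> l \<or> t \<in> l \<or> u \<in> l"
      "\<forall>l \<in> E a d b c. p \<in> l \<or> s \<in> l \<or> t \<in> l \<or> u \<in> l" "\<forall>l \<in> E b c a d. p \<in> l \<or> s \<in> l \<or> t \<in> l \<or> u \<in> l"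
      "\<forall>l \<in> E b d a c. p \<in> l \<or> s \<in> l \<or> t \<in> l \<or> u \<in> l" "\<forall>l \<in> E c d a b. p \<in> l \<or> s \<in> l \<or> t \<in> l \<or> u \<in> l"
    and "\<forall>l \<in> F a b c d. p \<in> l \<or> s \<in> l \<or> t \<in> l \<or> u \<in> l" "\<forall>l \<in> F a c b d. p \<in> l \<or> s \<in> l \<or> t \<in> l \<or> u \<in> l"
      "\<forall>l \<in> F a d b c. p \<in> l \<or> s \<in> l \<or> t \<in> l \<or> u \<in> l"
  shows "hit 4"
proof -
  have "{p, s, t, u} \<inter> l \<noteq> {} \<longleftrightarrow> p \<in> l \<or> s \<in> l \<or> t \<in> l \<or> u \<in> l" for l by blast
  then show ?thesis
    using assms by (intro hitI[of a b c d "{p, s, t, u}"]) (simp_all only:, auto simp: card_insert_if)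
qed

section \<open>Concurrence of classes that share an index\<close>

lemma adjacent_concurrent:
  assumes q: "quad a b c d" and e: "e \<in> E a b c d" and f: "f \<in> E a c b d"
  obtains p where "p \<in> d" "p \<in> e" "p \<in> f"
proof -
  note Ep = E_props[OF q e] and Fp = E_props[OF quad_perms(3)[OF q] f]
  note L = quad_L[OF q]
  have "e \<noteq> f" using Ep Fp by blast
  \<comment> \<open>\<open>e\<close> already meets \<open>b\<close> in the common point of
    \<open>a\<close> and \<open>b\<close>, so \<open>f\<close> would pass through that point,
    against its class. The argument for \<open>c\<close> is the same with \<open>e\<close> and
    \<open>f\<close> exchanged.\<close>
  have "\<not> conc b e f"
  proof
    assume "conc b e f"
    then obtain p where p: "p \<in> b" "p \<in> e" "p \<in> f" by (auto simp: conc_def)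
    obtain s where s: "s \<in> a" "s \<in> b" "s \<in> e" using Ep(6) by (auto simp: conc_def)
    have "p = s" using linear[of b e p s] p s Ep L by blast
    then show False using p s Fp by (auto simp: conc_def)
  qed
  moreover have "\<not> conc c e f"
  proof
    assume "conc c e f"
    then obtain p where p: "p \<in> c" "p \<in> e" "p \<in> f" by (auto simp: conc_def)
    obtain s where s: "s \<in> a" "s \<in> c" "s \<in> f" using Fp(6) by (auto simp: conc_def)
    have "p = s" using linear[of c f p s] p s Fp L by blast
    then show False using p s Ep by (auto simp: conc_def)
  qed
  ultimately have "conc d e f"
    using five_lines[of b c d e f] \<open>e \<noteq> f\<close> Ep Fp L q
    by (auto simp: quad_def conc_commute)
  then show thesis using that by (auto simp: conc_def)
qed

text \<open>Both lines meet \<open>f\<close> in its only point on \<open>d\<close> and also pass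
  through the \<open>ab\<close> point. If they differed, these two points would coincide, putting a
  point on \<open>a\<close>, \<open>b\<close> and \<open>d\<close>.\<close>

lemma adjacent_unique:
  assumes q: "quad a b c d" and e: "e \<in> E a b c d" "e' \<in> E a b c d" and f: "f \<in> E a c b d"
  shows "e = e'"
proof (rule ccontr)
  assume ne: "e \<noteq> e'"
  note Fp = E_props[OF quad_perms(3)[OF q] f]
  obtain p where p: "p \<in> d" "p \<in> e" "p \<in> f" using adjacent_concurrent[OF q e(1) f] .
  obtain p' where p': "p' \<in> d" "p' \<in> e'" "p' \<in> f" using adjacent_concurrent[OF q e(2) f] .
  have "p = p'" using linear[of d f p p'] p p' Fp quad_L[OF q] by blast
  obtain s where s: "s \<in> a" "s \<in> b" using E_props(6)[OF q e(1)] by (auto simp: conc_def)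
  then have "s \<in> e" "s \<in> e'" using E_hit[OF q] e by auto
  then have "s = p" using linear[of e e' s p] ne e p p' \<open>p = p'\<close> E_props[OF q] by blast
  then show False using s p quad_no3[OF q] by blast
qed

text \<open>The classes \<open>bc\<close>, \<open>bd\<close>, \<open>cd\<close> form a triangle in
  the class graph, any two of them sharing an index. All their lines meet in one point of the
  omitted line \<open>a\<close> as soon as two of the classes are nonempty.\<close>

lemma triangle_point:
  assumes q: "quad a b c d" and ne: "E b c a d \<noteq> {}" "E b d a c \<noteq> {}"
  obtains p where "p \<in> a" "\<forall>l \<in> E b c a d \<union> E b d a c \<union> E c d a b. p \<in> l"
proof -
  obtain e f where e: "e \<in> E b c a d" and f: "f \<in> E b d a c" using ne by blast
  have e': "e \<in> E b c d a" "e \<in> E c b d a" and f': "f \<in> E b d c a" "f \<in> E d b c a"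
    using e f by (simp_all add: swaps)
  note Q = quad_perms[OF q]
  obtain p where p: "p \<in> a" "p \<in> e" "p \<in> f"
    using adjacent_concurrent[OF Q(10) e'(1) f'(1)] .
  have "p \<in> l" if "l \<in> E b c a d" for l
    using adjacent_unique[OF Q(10) e'(1) _ f'(1), of l] that p by (simp add: swaps)
  moreover have "p \<in> l" if "l \<in> E b d a c" for l
    using adjacent_unique[OF Q(12) f'(1) _ e'(1), of l] that p by (simp add: swaps)
  \<comment> \<open>\<open>l\<close> and \<open>e\<close> share the index \<open>c\<close>, so they
    too meet on \<open>a\<close>, where \<open>e\<close> has only the point
    \<open>p\<close>.\<close>
  moreover have "p \<in> l" if l: "l \<in> E c d a b" for l
  proof -
    have "l \<in> E c d b a" using l by (simp add: swaps)
    then obtain s where s: "s \<in> a" "s \<in> e" "s \<in> l"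
      using adjacent_concurrent[OF Q(16) e'(2)] by blast
    have "s = p" using linear[of a e s p] s p E_props[OF Q(9) e] quad_L[OF q] by blast
    then show ?thesis using s by simp
  qed
  ultimately show thesis using that[OF p(1)] by blast
qed

lemma meet_point:
  assumes q: "quad a b c d" and ne: "a \<inter> b \<noteq> {}"
  obtains p where "p \<in> P" "p \<in> a" "p \<in> b" "\<forall>l \<in> E a b c d. p \<in> l" "\<forall>l \<in> F a b c d. p \<in> l"
proof -
  obtain p where p: "p \<in> a" "p \<in> b" using ne by blast
  show thesis
    using that[OF in_P[OF quad_L(1)[OF q] p(1)] p] E_hit[OF q p] F_hit[OF q p] by simp
qed

lemma E_meet: "E a b c d \<noteq> {} \<Longrightarrow> a \<inter> b \<noteq> {}"
  by (auto simp: E_def conc_def)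

lemma F_meet: "F a b c d \<noteq> {} \<Longrightarrow> a \<inter> b \<noteq> {}"
  by (auto simp: F_def conc_def)

text \<open>If \<open>a\<close> and \<open>b\<close> are disjoint, both classes are empty and any
  point of \<open>b\<close> serves. So the point meets \<open>b\<close> in either case, which lets
  transversals be built without asking which pairs intersect.\<close>

lemma spoke_point:
  assumes q: "quad a b c d"
  obtains p where "p \<in> P" "p \<in> b" "a \<inter> b \<noteq> {} \<longrightarrow> p \<in> a"
    "\<forall>l \<in> E a b c d. p \<in> l" "\<forall>l \<in> F a b c d. p \<in> l"
proof (cases "a \<inter> b = {}")
  case True
  then have "E a b c d = {}" "F a b c d = {}" using E_meet F_meet by blast+
  moreover obtain p where "p \<in> b" using line_point[OF quad_L(2)[OF q]] .
  ultimately show thesis using that[of p] True in_P[OF quad_L(2)[OF q]] by simp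
next
  case False
  show thesis by (rule meet_point[OF q False]) (rule that, auto)
qed

text \<open>Such a line contains both the \<open>ab\<close> point and the \<open>cd\<close> point.
  These are distinct because no three of the four lines concur, and two points determine a
  line.\<close>

lemma F_unique:
  assumes q: "quad a b c d" and f: "f \<in> F a b c d" "f' \<in> F a b c d" shows "f = f'"
proof (rule ccontr)
  assume ne: "f \<noteq> f'"
  obtain p s where ps: "p \<in> a" "p \<in> b" "s \<in> c" "s \<in> d" using F_props(6,7)[OF q f(1)] by (auto simp: conc_def)
  have "p \<in> f" "p \<in> f'" using F_hit[OF q] ps f by auto
  moreover have "s \<in> f" "s \<in> f'" using F_hit[OF quad_perms(17)[OF q]] ps f by (auto simp: swaps)
  ultimately have "p = s" using linear[of f f' p s] ne F_props(1)[OF q] f by blast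
  then show False using ps quad_no3[OF q] by blast
qed

lemma exists_extra:
  obtains l where "l \<in> L" "l \<notin> {a, b, c, d}"
proof -
  have "card {a, b, c, d} \<le> 4" by (simp add: card_insert_if)
  then have "\<not> L \<subseteq> {a, b, c, d}" using card_L card_mono[of "{a, b, c, d}" L] by fastforce
  then show thesis using that by blast
qed

section \<open>Transversals of size three and four\<close>

text \<open>Every nonempty class now involves \<open>a\<close>, each \<open>F\<close> class doing so
  through one of its two points, so the spoke points from \<open>a\<close> to \<open>b\<close>,
  \<open>c\<close>, \<open>d\<close> meet all classes and these three lines. A line outside the four
  forces one of these pairs to intersect, and then \<open>a\<close> is met too.\<close>

lemma hit_star:
  assumes q: "quad a b c d" and em: "E b c a d = {}" "E b d a c = {}" "E c d a b = {}"
  shows "hit 3"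
proof -
  note Q = quad_perms[OF q]
  obtain l where l: "l \<in> L" "l \<notin> {a, b, c, d}" using exists_extra .
  have meet: "a \<inter> b \<noteq> {} \<or> a \<inter> c \<noteq> {} \<or> a \<inter> d \<noteq> {}"
    using line_cases[OF q l(1)] l(2) em E_meet F_meet by blast
  obtain p where p: "p \<in> P" "p \<in> b" "a \<inter> b \<noteq> {} \<longrightarrow> p \<in> a"
    "\<forall>l \<in> E a b c d. p \<in> l" "\<forall>l \<in> F a b c d. p \<in> l" using spoke_point[OF Q(1)] .
  obtain s where s: "s \<in> P" "s \<in> c" "a \<inter> c \<noteq> {} \<longrightarrow> s \<in> a"
    "\<forall>l \<in> E a c b d. s \<in> l" "\<forall>l \<in> F a c b d. s \<in> l" using spoke_point[OF Q(3)] .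
  obtain t where t: "t \<in> P" "t \<in> d" "a \<inter> d \<noteq> {} \<longrightarrow> t \<in> a"
    "\<forall>l \<in> E a d b c. t \<in> l" "\<forall>l \<in> F a d b c. t \<in> l" using spoke_point[OF Q(5)] .
  show ?thesis using p s t em meet by (intro hit3I[OF q, of p s t]) auto
qed

text \<open>Three spoke points from \<open>a\<close> as in \<open>hit_star\<close>; the triangle
  point on \<open>a\<close> takes the classes avoiding \<open>a\<close>, and \<open>a\<close>
  itself.\<close>

lemma hit4_two_classes:
  assumes q: "quad a b c d" and ne: "E b c a d \<noteq> {}" "E b d a c \<noteq> {}"
  shows "hit 4"
proof -
  note Q = quad_perms[OF q]
  obtain p where p: "p \<in> P" "p \<in> b" "a \<inter> b \<noteq> {} \<longrightarrow> p \<in> a"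
    "\<forall>l \<in> E a b c d. p \<in> l" "\<forall>l \<in> F a b c d. p \<in> l" using spoke_point[OF Q(1)] .
  obtain s where s: "s \<in> P" "s \<in> c" "a \<inter> c \<noteq> {} \<longrightarrow> s \<in> a"
    "\<forall>l \<in> E a c b d. s \<in> l" "\<forall>l \<in> F a c b d. s \<in> l" using spoke_point[OF Q(3)] .
  obtain t where t: "t \<in> P" "t \<in> d" "a \<inter> d \<noteq> {} \<longrightarrow> t \<in> a"
    "\<forall>l \<in> E a d b c. t \<in> l" "\<forall>l \<in> F a d b c. t \<in> l" using spoke_point[OF Q(5)] .
  obtain u where u: "u \<in> a" "\<forall>l \<in> E b c a d \<union> E b d a c \<union> E c d a b. u \<in> l"
    using triangle_point[OF q ne] .
  have "u \<in> P" using u in_P quad_L[OF q] by blast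
  then show ?thesis using p s t u by (intro hit4I[OF q, of p s t u]) simp_all
qed

text \<open>The \<open>bc\<close> point takes the one class avoiding \<open>a\<close> together with
  \<open>b\<close> and \<open>c\<close>. The spoke points for \<open>ab\<close> and
  \<open>ac\<close> can therefore be placed on \<open>a\<close>, so that \<open>a\<close> is met
  even where a pair is disjoint.\<close>

lemma hit4_one_class:
  assumes q: "quad a b c d" and ne: "E b c a d \<noteq> {}" and em: "E b d a c = {}" "E c d a b = {}"
  shows "hit 4"
proof -
  note Q = quad_perms[OF q]
  obtain p where p: "p \<in> P" "p \<in> a" "b \<inter> a \<noteq> {} \<longrightarrow> p \<in> b"
    "\<forall>l \<in> E b a c d. p \<in> l" "\<forall>l \<in> F b a c d. p \<in> l" using spoke_point[OF Q(7)] .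
  obtain s where s: "s \<in> P" "s \<in> a" "c \<inter> a \<noteq> {} \<longrightarrow> s \<in> c"
    "\<forall>l \<in> E c a b d. s \<in> l" "\<forall>l \<in> F c a b d. s \<in> l" using spoke_point[OF Q(13)] .
  obtain t where t: "t \<in> P" "t \<in> d" "a \<inter> d \<noteq> {} \<longrightarrow> t \<in> a"
    "\<forall>l \<in> E a d b c. t \<in> l" "\<forall>l \<in> F a d b c. t \<in> l" using spoke_point[OF Q(5)] .
  obtain u where u: "u \<in> P" "u \<in> b" "u \<in> c" "\<forall>l \<in> E b c a d. u \<in> l" "\<forall>l \<in> F b c a d. u \<in> l"
    using meet_point[OF Q(9) E_meet[OF ne]] .
  show ?thesis using p s t u em by (intro hit4I[OF q, of p s t u]) (simp_all add: swaps)
qed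

lemma hit_mono: "hit j \<Longrightarrow> j \<le> k \<Longrightarrow> hit k"
  unfolding hit_def by (meson le_trans)

lemma hit_4:
  assumes q: "quad a b c d" shows "hit 4"
proof -
  note Q = quad_perms[OF q]
  \<comment> \<open>By the number of nonempty classes avoiding \<open>a\<close>: none gives
    \<open>hit_star\<close>, one gives \<open>hit4_one_class\<close>, two or three give
    \<open>hit4_two_classes\<close>.\<close>
  show ?thesis
    using hit_mono[OF hit_star[OF Q(1)], of 4] hit4_two_classes[OF Q(1)]
      hit4_two_classes[OF Q(3)] hit4_two_classes[OF Q(5)]
      hit4_one_class[OF Q(1)] hit4_one_class[OF Q(2)] hit4_one_class[OF Q(4)]
    by (simp add: swaps) blast
qed

section \<open>Counting points and lines\<close>

definition meetings :: "'a set \<Rightarrow> 'a set \<Rightarrow> 'a set \<Rightarrow> 'a set \<Rightarrow> nat" where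
  "meetings a b c d = meets a b + meets a c + meets a d + meets b c + meets b d + meets c d"

lemma meetings_le_6: "meetings a b c d \<le> 6"
  unfolding meetings_def
  using meets_le_1[of a b] meets_le_1[of a c] meets_le_1[of a d]
    meets_le_1[of b c] meets_le_1[of b d] meets_le_1[of c d] by linarith

lemma card_inter_lines:
  assumes "x \<in> L" "y \<in> L" "x \<noteq> y" shows "card (x \<inter> y) \<le> meets x y"
proof (cases "x \<inter> y = {}")
  case False
  then obtain p where p: "p \<in> x" "p \<in> y" by blast
  have "x \<inter> y \<subseteq> {p}" using linear[OF assms _ _ p] by auto
  then have "card (x \<inter> y) \<le> 1" using card_mono[of "{p}" "x \<inter> y"] by simp
  then show ?thesis using meets_eq_1[OF p] by simp
qed simp

text \<open>Adding the lines one at a time, each new line loses at most one point for every earlier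
  line that it meets.\<close>

lemma card_union_lines:
  assumes q: "quad a b c d"
  shows "4 * r \<le> card (a \<union> b \<union> c \<union> d) + meetings a b c d"
proof -
  note L = quad_L[OF q]
  note fin = L(1-4)[THEN finite_line] and cd = L(1-4)[THEN uniform]
  have 1: "card a + card b = card (a \<union> b) + card (a \<inter> b)"
    using fin by (intro card_Un_Int) simp_all
  have 2: "card (a \<union> b) + card c = card (a \<union> b \<union> c) + card ((a \<union> b) \<inter> c)"
    using fin by (intro card_Un_Int) simp_all
  have 3: "card (a \<union> b \<union> c) + card d = card (a \<union> b \<union> c \<union> d) + card ((a \<union> b \<union> c) \<inter> d)"
    using fin by (intro card_Un_Int) simp_all
  have 4: "card ((a \<union> b) \<inter> c) \<le> card (a \<inter> c) + card (b \<inter> c)"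
    by (simp add: Int_Un_distrib2 card_Un_le)
  have "card ((a \<union> b \<union> c) \<inter> d) \<le> card ((a \<inter> d) \<union> (b \<inter> d)) + card (c \<inter> d)"
    by (simp add: Int_Un_distrib2 card_Un_le)
  also have "card ((a \<inter> d) \<union> (b \<inter> d)) \<le> card (a \<inter> d) + card (b \<inter> d)"
    by (rule card_Un_le)
  finally have 5: "card ((a \<union> b \<union> c) \<inter> d) \<le> card (a \<inter> d) + card (b \<inter> d) + card (c \<inter> d)"
    by simp
  show ?thesis
    unfolding meetings_def
    using 1 2 3 4 5 cd card_inter_lines[OF L(1,2,5)] card_inter_lines[OF L(1,3,6)]
      card_inter_lines[OF L(1,4,7)] card_inter_lines[OF L(2,3,8)] card_inter_lines[OF L(2,4,9)]
      card_inter_lines[OF L(3,4,10)]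
    by linarith
qed

lemma card_P_ge:
  assumes q: "quad a b c d" and X: "X \<subseteq> P" "X \<inter> (a \<union> b \<union> c \<union> d) = {}"
  shows "4 * r + card X \<le> card P + meetings a b c d"
proof -
  have U: "a \<union> b \<union> c \<union> d \<subseteq> P" using quad_L[OF q] line_subset by simp
  have "card X + card (a \<union> b \<union> c \<union> d) = card (X \<union> (a \<union> b \<union> c \<union> d))"
    using X U finite_P by (intro card_Un_disjoint[symmetric]) (auto intro: finite_subset)
  also have "\<dots> \<le> card P" using X U by (intro card_mono finite_P) auto
  finally show ?thesis using card_union_lines[OF q] by linarith
qed

text \<open>A line of this class meets \<open>a\<close> and \<open>b\<close> only in their common
  point, and \<open>c\<close> and \<open>d\<close> only in theirs.\<close>

lemma F_outside:
  assumes q: "quad a b c d" and f: "f \<in> F a b c d"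
  shows "r \<le> card (f - (a \<union> b \<union> c \<union> d)) + 2"
proof -
  note Fp = F_props[OF q f] and L = quad_L[OF q]
  obtain p where p: "p \<in> a" "p \<in> b" "p \<in> f" using Fp(6) by (auto simp: conc_def)
  obtain s where s: "s \<in> c" "s \<in> d" "s \<in> f" using Fp(7) by (auto simp: conc_def)
  have "f \<inter> (a \<union> b \<union> c \<union> d) \<subseteq> {p, s}"
  proof
    fix x assume x: "x \<in> f \<inter> (a \<union> b \<union> c \<union> d)"
    show "x \<in> {p, s}"
      using linear[of f a x p] linear[of f b x p] linear[of f c x s] linear[of f d x s] x p s Fp L
      by fastforce
  qed
  then have "card (f \<inter> (a \<union> b \<union> c \<union> d)) \<le> card {p, s}" by (intro card_mono) auto
  also have "\<dots> \<le> 2" by (simp add: card_insert_if)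
  finally have "card (f \<inter> (a \<union> b \<union> c \<union> d)) \<le> 2" .
  moreover have "card f = card (f \<inter> (a \<union> b \<union> c \<union> d)) + card (f - (a \<union> b \<union> c \<union> d))"
    using card_Int_Diff finite_line Fp(1) by blast
  ultimately show ?thesis using uniform[OF Fp(1)] by linarith
qed

lemma card_P_ge_F:
  assumes q: "quad a b c d" and "F a b c d \<noteq> {} \<or> F a c b d \<noteq> {} \<or> F a d b c \<noteq> {}"
  shows "5 * r \<le> card P + meetings a b c d + 2"
proof -
  note Q = quad_perms[OF q]
  have U: "a \<union> c \<union> b \<union> d = a \<union> b \<union> c \<union> d" "a \<union> d \<union> b \<union> c = a \<union> b \<union> c \<union> d" by auto
  obtain f where f: "f \<in> L" "r \<le> card (f - (a \<union> b \<union> c \<union> d)) + 2"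
    using assms(2) F_outside[OF Q(1)] F_outside[OF Q(3), unfolded U] F_outside[OF Q(5), unfolded U]
      F_props(1)[OF Q(1)] F_props(1)[OF Q(3)] F_props(1)[OF Q(5)]
    by blast
  then show ?thesis
    using card_P_ge[OF q, of "f - (a \<union> b \<union> c \<union> d)"] line_subset[OF f(1)] by fastforce
qed

lemma three_points:
  assumes q: "quad a b c d" and m: "a \<inter> b \<noteq> {}" "a \<inter> c \<noteq> {}" "a \<inter> d \<noteq> {}"
  shows "3 \<le> r"
proof -
  obtain p s t where p: "p \<in> a" "p \<in> b" "s \<in> a" "s \<in> c" "t \<in> a" "t \<in> d" using m by blast
  then have "p \<noteq> s" "p \<noteq> t" "s \<noteq> t" using quad_no3[OF q] by auto
  then have "card {p, s, t} = 3" by simp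
  then show ?thesis
    using p card_mono[OF finite_line, of a "{p, s, t}"] uniform[of a] quad_L(1)[OF q] by simp
qed

text \<open>Supplies the extra point of \<open>a\<close> that \<open>four_points\<close> asks
  for.\<close>

lemma triangle_point_off:
  assumes q: "quad a b c d" and e: "e \<in> E b c a d" and p: "p \<in> a" "p \<in> e"
  shows "p \<notin> b" "p \<notin> c" "p \<notin> d"
proof -
  note Ep = E_props[OF quad_perms(9)[OF q] e]
  show "p \<notin> b" "p \<notin> c" "p \<notin> d" using Ep p by (auto simp: conc_def)
qed

lemma four_points:
  assumes q: "quad a b c d" and m: "a \<inter> b \<noteq> {}" "a \<inter> c \<noteq> {}" "a \<inter> d \<noteq> {}"
    and u: "u \<in> a" "u \<notin> b" "u \<notin> c" "u \<notin> d"
  shows "4 \<le> r"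
proof -
  obtain p s t where p: "p \<in> a" "p \<in> b" "s \<in> a" "s \<in> c" "t \<in> a" "t \<in> d" using m by blast
  then have "p \<noteq> s" "p \<noteq> t" "s \<noteq> t" "p \<noteq> u" "s \<noteq> u" "t \<noteq> u" using quad_no3[OF q] u by auto
  then have "card {p, s, t, u} = 4" by simp
  then show ?thesis
    using p u card_mono[OF finite_line, of a "{p, s, t, u}"] uniform[of a] quad_L(1)[OF q] by simp
qed

definition classes :: "'a set \<Rightarrow> 'a set \<Rightarrow> 'a set \<Rightarrow> 'a set \<Rightarrow> nat" where
  "classes a b c d = of_bool (E a b c d \<noteq> {}) + of_bool (E a c b d \<noteq> {}) + of_bool (E a d b c \<noteq> {}) +
    of_bool (E b c a d \<noteq> {}) + of_bool (E b d a c \<noteq> {}) + of_bool (E c d a b \<noteq> {}) +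
    of_bool (F a b c d \<noteq> {}) + of_bool (F a c b d \<noteq> {}) + of_bool (F a d b c \<noteq> {})"

lemma card_Un_disjoint_ge:
  fixes A B :: "'a set set"
  assumes "A \<subseteq> L" "B \<subseteq> L" "A \<inter> B = {}"
  shows "card A + of_bool (B \<noteq> {}) \<le> card (A \<union> B)"
proof -
  have fin: "finite A" "finite B" using assms finite_subset[OF _ finite_L] by blast+
  then have "of_bool (B \<noteq> {}) \<le> card B" by (simp add: Suc_le_eq card_gt_0_iff)
  then show ?thesis using card_Un_disjoint[OF fin assms(3)] by simp
qed

text \<open>The class of a line can be read off from which of the six pairs it is concurrent with.
  The nine classes are thus pairwise disjoint, and each nonempty one contributes a line besides
  \<open>a, b, c, d\<close>.\<close>

lemma card_L_ge:
  assumes q: "quad a b c d"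
  shows "4 + classes a b c d \<le> card L"
proof -
  note Q = quad_perms[OF q]
  have Es: "E a b c d \<subseteq> L" "E a c b d \<subseteq> L" "E a d b c \<subseteq> L" "E b c a d \<subseteq> L" "E b d a c \<subseteq> L"
    "E c d a b \<subseteq> L" "F a b c d \<subseteq> L" "F a c b d \<subseteq> L" "F a d b c \<subseteq> L" "{a, b, c, d} \<subseteq> L"
    using quad_L[OF q] by (auto simp: E_def F_def)
  have sig: "conc a b l \<and> \<not> conc a c l \<and> \<not> conc a d l \<and> \<not> conc b c l \<and> \<not> conc b d l \<and> \<not> conc c d l \<and>
      l \<notin> {a, b, c, d}" if "l \<in> E a b c d" for l
    using E_props[OF Q(1) that] by simp
  have sig2: "\<not> conc a b l \<and> conc a c l \<and> \<not> conc a d l \<and> \<not> conc b c l \<and> \<not> conc b d l \<and> \<not> conc c d l \<and>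
      l \<notin> {a, b, c, d}" if "l \<in> E a c b d" for l
    using E_props[OF Q(3) that] by (simp add: conc_commute)
  have sig3: "\<not> conc a b l \<and> \<not> conc a c l \<and> conc a d l \<and> \<not> conc b c l \<and> \<not> conc b d l \<and> \<not> conc c d l \<and>
      l \<notin> {a, b, c, d}" if "l \<in> E a d b c" for l
    using E_props[OF Q(5) that] by (simp add: conc_commute)
  have sig4: "\<not> conc a b l \<and> \<not> conc a c l \<and> \<not> conc a d l \<and> conc b c l \<and> \<not> conc b d l \<and> \<not> conc c d l \<and>
      l \<notin> {a, b, c, d}" if "l \<in> E b c a d" for l
    using E_props[OF Q(9) that] by (simp add: conc_commute)
  have sig5: "\<not> conc a b l \<and> \<not> conc a c l \<and> \<not> conc a d l \<and> \<not> conc b c l \<and> conc b d l \<and> \<not> conc c d l \<and>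
      l \<notin> {a, b, c, d}" if "l \<in> E b d a c" for l
    using E_props[OF Q(11) that] by (simp add: conc_commute)
  have sig6: "\<not> conc a b l \<and> \<not> conc a c l \<and> \<not> conc a d l \<and> \<not> conc b c l \<and> \<not> conc b d l \<and> conc c d l \<and>
      l \<notin> {a, b, c, d}" if "l \<in> E c d a b" for l
    using E_props[OF Q(17) that] by (simp add: conc_commute)
  have sig7: "conc a b l \<and> \<not> conc a c l \<and> \<not> conc a d l \<and> \<not> conc b c l \<and> \<not> conc b d l \<and> conc c d l \<and>
      l \<notin> {a, b, c, d}" if "l \<in> F a b c d" for l
    using F_props[OF Q(1) that] by (simp add: conc_commute)
  have sig8: "\<not> conc a b l \<and> conc a c l \<and> \<not> conc a d l \<and> \<not> conc b c l \<and> conc b d l \<and> \<not> conc c d l \<and>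
      l \<notin> {a, b, c, d}" if "l \<in> F a c b d" for l
    using F_props[OF Q(3) that] by (simp add: conc_commute)
  have sig9: "\<not> conc a b l \<and> \<not> conc a c l \<and> conc a d l \<and> conc b c l \<and> \<not> conc b d l \<and> \<not> conc c d l \<and>
      l \<notin> {a, b, c, d}" if "l \<in> F a d b c" for l
    using F_props[OF Q(5) that] by (simp add: conc_commute)
  have U: "{a, b, c, d} \<inter> E a b c d = {}"
    "({a, b, c, d} \<union> E a b c d) \<inter> E a c b d = {}"
    "({a, b, c, d} \<union> E a b c d \<union> E a c b d) \<inter> E a d b c = {}"
    "({a, b, c, d} \<union> E a b c d \<union> E a c b d \<union> E a d b c) \<inter> E b c a d = {}"
    "({a, b, c, d} \<union> E a b c d \<union> E a c b d \<union> E a d b c \<union> E b c a d) \<inter> E b d a c = {}"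
    "({a, b, c, d} \<union> E a b c d \<union> E a c b d \<union> E a d b c \<union> E b c a d \<union> E b d a c) \<inter> E c d a b = {}"
    "({a, b, c, d} \<union> E a b c d \<union> E a c b d \<union> E a d b c \<union> E b c a d \<union> E b d a c \<union> E c d a b) \<inter>
      F a b c d = {}"
    "({a, b, c, d} \<union> E a b c d \<union> E a c b d \<union> E a d b c \<union> E b c a d \<union> E b d a c \<union> E c d a b \<union>
      F a b c d) \<inter> F a c b d = {}"
    "({a, b, c, d} \<union> E a b c d \<union> E a c b d \<union> E a d b c \<union> E b c a d \<union> E b d a c \<union> E c d a b \<union>
      F a b c d \<union> F a c b d) \<inter> F a d b c = {}"
    unfolding disjoint_iff Un_iff using sig sig2 sig3 sig4 sig5 sig6 sig7 sig8 sig9 by metis+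
  have "card {a, b, c, d} = 4" using quad_L[OF q] by simp
  then have "4 + classes a b c d \<le> card ({a, b, c, d} \<union> E a b c d \<union> E a c b d \<union> E a d b c \<union> E b c a d \<union>
      E b d a c \<union> E c d a b \<union> F a b c d \<union> F a c b d \<union> F a d b c)"
    unfolding classes_def
    using U[THEN card_Un_disjoint_ge[rotated 2]] Es by simp
  also have "\<dots> \<le> card L" using Es by (intro card_mono finite_L) simp
  finally show ?thesis .
qed

lemma E_perms:
  "E b a c d = E a b c d" "E b a d c = E a b c d" "E a b d c = E a b c d"
  "E c a b d = E a c b d" "E c a d b = E a c b d" "E a c d b = E a c b d"
  "E d a b c = E a d b c" "E d a c b = E a d b c" "E a d c b = E a d b c"
  "E c b a d = E b c a d" "E c b d a = E b c a d" "E b c d a = E b c a d"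
  "E d b a c = E b d a c" "E d b c a = E b d a c" "E b d c a = E b d a c"
  "E d c a b = E c d a b" "E d c b a = E c d a b" "E c d b a = E c d a b"
  by (metis E_swap)+

lemma F_perms:
  "F c a b d = F a c b d" "F c b a d = F a d b c" "F c a d b = F a c b d" "F c b d a = F a d b c"
  "F b a c d = F a b c d" "F b d a c = F a c b d" "F b a d c = F a b c d" "F b c a d = F a d b c"
  "F a c d b = F a c b d" "F a b d c = F a b c d" "F a d c b = F a d b c" "F b d c a = F a c b d" "F b c d a = F a d b c"
  by (metis F_swap)+

text \<open>For use with the four lines fixed, where every right-hand side is the canonical name of
  its class.\<close>

lemmas class_perms = E_perms F_perms

text \<open>If \<open>a\<close> meets all three other lines, it does so in three distinct points, so
  \<open>3 \<le> r\<close>; otherwise the sum is at most 2.\<close>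

lemma degree_le:
  assumes q: "quad a b c d" shows "meets a b + meets a c + meets a d \<le> r"
  using three_points[OF q] r_ge_2
  by (cases "a \<inter> b = {}"; cases "a \<inter> c = {}"; cases "a \<inter> d = {}") (simp_all add: meets_def)

text \<open>Adding \<open>degree_le\<close> over the four lines counts every pair twice, hence the
  bound \<open>2 * r\<close>. The second bound is the average of \<open>2 * r\<close> and 6.\<close>

lemma meetings_le:
  assumes q: "quad a b c d" shows "meetings a b c d \<le> 2 * r" "meetings a b c d \<le> r + 3"
proof -
  note Q = quad_perms[OF q]
  show *: "meetings a b c d \<le> 2 * r"
    using degree_le[OF Q(1)] degree_le[OF Q(7)] degree_le[OF Q(13)] degree_le[OF Q(19)]
    unfolding meetings_def
    by (simp add: meets_commute[of b a] meets_commute[of c a] meets_commute[of d a]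
        meets_commute[of c b] meets_commute[of d b] meets_commute[of d c])
  then show "meetings a b c d \<le> r + 3" using meetings_le_6[of a b c d] by linarith
qed

lemma large_if_classes:
  assumes q: "quad a b c d" and "meetings a b c d \<le> classes a b c d"
  shows "4 * r + 4 \<le> card P + card L"
  using card_P_ge[OF q, of "{}"] card_L_ge[OF q] assms(2) by simp

text \<open>The \<open>r - 2\<close> points of an \<open>F\<close> line off the four lines improve
  the bound on \<open>card P\<close>, relaxing the demand on the number of classes by
  \<open>r - 2\<close>.\<close>

lemma large_if_F:
  assumes q: "quad a b c d" and "F a b c d \<noteq> {} \<or> F a c b d \<noteq> {} \<or> F a d b c \<noteq> {}"
    and "meetings a b c d + 2 \<le> classes a b c d + r"
  shows "4 * r + 4 \<le> card P + card L"
  using card_P_ge_F[OF q assms(2)] card_L_ge[OF q] assms(3) by linarith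

section \<open>Case analysis over the graph of nonempty \<open>E\<close> classes\<close>

text \<open>The triangle point takes \<open>a\<close> and all \<open>E\<close> lines. Any two of the
  points \<open>bc\<close>, \<open>bd\<close>, \<open>cd\<close> take the other three lines and one
  \<open>F\<close> class each, which suffices if some \<open>F\<close> class is empty. Otherwise all
  six possible intersections are matched by six classes.\<close>

lemma case_triangle:
  assumes q: "quad a b c d" and ne: "E b c a d \<noteq> {}" "E b d a c \<noteq> {}" "E c d a b \<noteq> {}"
    and em: "E a b c d = {}" "E a c b d = {}" "E a d b c = {}"
  shows "hit 3 \<or> 4 * r + 4 \<le> card P + card L"
proof -
  note Q = quad_perms[OF q]
  obtain u where u: "u \<in> a" "\<forall>l \<in> E b c a d \<union> E b d a c \<union> E c d a b. u \<in> l"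
    using triangle_point[OF q ne(1,2)] .
  have uP: "u \<in> P" using u in_P quad_L[OF q] by blast
  obtain p where p: "p \<in> P" "p \<in> b" "p \<in> c" "\<forall>l \<in> F b c a d. p \<in> l"
    using meet_point[OF Q(9) E_meet[OF ne(1)]] by metis
  obtain s where s: "s \<in> P" "s \<in> b" "s \<in> d" "\<forall>l \<in> F b d a c. s \<in> l"
    using meet_point[OF Q(11) E_meet[OF ne(2)]] by metis
  obtain t where t: "t \<in> P" "t \<in> c" "t \<in> d" "\<forall>l \<in> F c d a b. t \<in> l"
    using meet_point[OF Q(17) E_meet[OF ne(3)]] by metis
  note sw = F_swap(3)[of b c a d] F_swap(3)[of b d a c] F_swap(3)[of c d a b]
  have "hit 3" if "F a b c d = {}"
    using u p s em that uP by (intro hit3I[OF q, of u p s]) (simp_all add: sw F_swap(1-2))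
  moreover have "hit 3" if "F a c b d = {}"
    using u p t em that uP by (intro hit3I[OF q, of u p t]) (simp_all add: sw F_swap(1-2))
  moreover have "hit 3" if "F a d b c = {}"
    using u s t em that uP by (intro hit3I[OF q, of u s t]) (simp_all add: sw F_swap(1-2))
  moreover have "4 * r + 4 \<le> card P + card L"
    if "F a b c d \<noteq> {}" "F a c b d \<noteq> {}" "F a d b c \<noteq> {}"
    using large_if_classes[OF q] meetings_le_6[of a b c d] ne that by (simp add: classes_def)
  ultimately show ?thesis by blast
qed

text \<open>The triangle point on \<open>a\<close>, the \<open>ab\<close> point and the
  \<open>cd\<close> point miss at most the \<open>F\<close> classes \<open>ac|bd\<close> and
  \<open>ad|bc\<close>. If one of these is nonempty, there are five classes, enough for
  \<open>large_if_F\<close> because at most \<open>r + 3\<close> pairs meet.\<close>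

lemma case_paw:
  assumes q: "quad a b c d" and ne: "E b c a d \<noteq> {}" "E b d a c \<noteq> {}" "E c d a b \<noteq> {}" "E a b c d \<noteq> {}"
    and em: "E a c b d = {}" "E a d b c = {}"
  shows "hit 3 \<or> 4 * r + 4 \<le> card P + card L"
proof -
  note Q = quad_perms[OF q]
  obtain u where u: "u \<in> a" "\<forall>l \<in> E b c a d \<union> E b d a c \<union> E c d a b. u \<in> l"
    using triangle_point[OF q ne(1,2)] .
  have uP: "u \<in> P" using u in_P quad_L[OF q] by blast
  obtain p where p: "p \<in> P" "p \<in> a" "p \<in> b" "\<forall>l \<in> E a b c d. p \<in> l" "\<forall>l \<in> F a b c d. p \<in> l"
    using meet_point[OF Q(1) E_meet[OF ne(4)]] .
  obtain t where t: "t \<in> P" "t \<in> c" "t \<in> d"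
    using meet_point[OF Q(17) E_meet[OF ne(3)]] by metis
  have "hit 3" if "F a c b d = {}" "F a d b c = {}"
    using u p t em that uP by (intro hit3I[OF q, of u p t]) simp_all
  moreover have "4 * r + 4 \<le> card P + card L" if "F a c b d \<noteq> {} \<or> F a d b c \<noteq> {}"
    using large_if_F[OF q] meetings_le(2)[OF q] ne that by (auto simp: classes_def)
  ultimately show ?thesis by blast
qed

text \<open>Only the edge \<open>cd\<close> is missing, so the triangles \<open>abc\<close> and
  \<open>abd\<close> have points on \<open>d\<close> and \<open>c\<close> taking all
  \<open>E\<close> lines. The \<open>ab\<close> point completes the transversal unless a sixth class
  appears.\<close>

lemma case_five:
  assumes q: "quad a b c d"
    and ne: "E a b c d \<noteq> {}" "E a c b d \<noteq> {}" "E a d b c \<noteq> {}" "E b c a d \<noteq> {}" "E b d a c \<noteq> {}"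
    and em: "E c d a b = {}"
  shows "hit 3 \<or> 4 * r + 4 \<le> card P + card L"
proof -
  note Q = quad_perms[OF q]
  have ne': "E a b d c \<noteq> {}" "E a c d b \<noteq> {}" "E a d c b \<noteq> {}" using ne by (simp_all add: swaps)
  obtain u where u: "u \<in> d" "\<forall>l \<in> E a b d c \<union> E a c d b \<union> E b c d a. u \<in> l"
    using triangle_point[OF Q(19) ne'(1,2)] .
  obtain v where v: "v \<in> c" "\<forall>l \<in> E a b c d \<union> E a d c b \<union> E b d c a. v \<in> l"
    using triangle_point[OF Q(13) ne(1) ne'(3)] .
  have uvP: "u \<in> P" "v \<in> P" using u v in_P quad_L[OF q] by blast+
  obtain p where p: "p \<in> P" "p \<in> a" "p \<in> b" "\<forall>l \<in> E a b c d. p \<in> l" "\<forall>l \<in> F a b c d. p \<in> l"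
    using meet_point[OF Q(1) E_meet[OF ne(1)]] .
  have "hit 3" if "F a c b d = {}" "F a d b c = {}"
    using u v p em that uvP by (intro hit3I[OF q, of u v p]) (simp_all add: swaps)
  moreover have "4 * r + 4 \<le> card P + card L" if "F a c b d \<noteq> {} \<or> F a d b c \<noteq> {}"
    using large_if_classes[OF q] meetings_le_6[of a b c d] ne that by (auto simp: classes_def)
  ultimately show ?thesis by blast
qed

lemma case_six:
  assumes q: "quad a b c d"
    and ne: "E a b c d \<noteq> {}" "E a c b d \<noteq> {}" "E a d b c \<noteq> {}" "E b c a d \<noteq> {}" "E b d a c \<noteq> {}" "E c d a b \<noteq> {}"
  shows "hit 3 \<or> 4 * r + 4 \<le> card P + card L"
  using large_if_classes[OF q] meetings_le_6[of a b c d] ne by (simp add: classes_def)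

text \<open>The two edges at \<open>b\<close> and the two at \<open>d\<close> give triangle points
  on \<open>d\<close> and \<open>b\<close>, which together take all \<open>E\<close> lines; an
  \<open>ac\<close> point then takes \<open>a\<close> and \<open>c\<close>. A \<open>bd\<close>
  point works likewise with triangle points on \<open>c\<close> and \<open>a\<close>. If neither
  diagonal pair meets, at most four pairs do, matched by the four classes.\<close>

lemma case_cycle:
  assumes q: "quad a b c d"
    and ne: "E a b c d \<noteq> {}" "E b c a d \<noteq> {}" "E c d a b \<noteq> {}" "E a d b c \<noteq> {}"
    and em: "E a c b d = {}" "E b d a c = {}"
  shows "hit 3 \<or> 4 * r + 4 \<le> card P + card L"
proof -
  note S = class_perms[where a = a and b = b and c = c and d = d]
  note Q = quad_perms[OF q]
  have ne': "E b a d c \<noteq> {}" "E b c d a \<noteq> {}" "E d a b c \<noteq> {}" "E d c b a \<noteq> {}"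
    "E a b c d \<noteq> {}" "E a d c b \<noteq> {}" "E c b a d \<noteq> {}" "E c d a b \<noteq> {}"
    using ne by (simp_all add: swaps)
  obtain u where u: "u \<in> d" "\<forall>l \<in> E b a d c \<union> E b c d a \<union> E a c d b. u \<in> l"
    using triangle_point[OF Q(21) ne'(1,2)] .
  obtain v where v: "v \<in> b" "\<forall>l \<in> E d a b c \<union> E d c b a \<union> E a c b d. v \<in> l"
    using triangle_point[OF Q(11) ne'(3,4)] .
  obtain u' where u': "u' \<in> c" "\<forall>l \<in> E a b c d \<union> E a d c b \<union> E b d c a. u' \<in> l"
    using triangle_point[OF Q(13) ne'(5,6)] .
  obtain v' where v': "v' \<in> a" "\<forall>l \<in> E c b a d \<union> E c d a b \<union> E b d a c. v' \<in> l"
    using triangle_point[OF Q(3) ne'(7,8)] .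
  have inP: "u \<in> P" "v \<in> P" "u' \<in> P" "v' \<in> P"
    using in_P u(1) v(1) u'(1) v'(1) quad_L(1-4)[OF q] by simp_all
  have "hit 3" if m: "a \<inter> c \<noteq> {}" "F a b c d = {}" "F a c b d = {}" "F a d b c = {}"
  proof -
    obtain p where "p \<in> P" "p \<in> a" "p \<in> c" using meet_point[OF Q(3) m(1)] by metis
    then show ?thesis
      using u v em m(2-) inP by (intro hit3I[OF q, of u v p]) (simp_all add: S)
  qed
  moreover have "hit 3" if m: "b \<inter> d \<noteq> {}" "F a b c d = {}" "F a c b d = {}" "F a d b c = {}"
  proof -
    obtain p where "p \<in> P" "p \<in> b" "p \<in> d" using meet_point[OF Q(11) m(1)] by metis
    then show ?thesis
      using u' v' em m(2-) inP by (intro hit3I[OF q, of u' v' p]) (simp_all add: S)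
  qed
  moreover have "4 * r + 4 \<le> card P + card L"
    if "F a b c d \<noteq> {} \<or> F a c b d \<noteq> {} \<or> F a d b c \<noteq> {}"
    using large_if_F[OF q that] meetings_le(2)[OF q] ne that by (auto simp: classes_def)
  moreover have "4 * r + 4 \<le> card P + card L" if "a \<inter> c = {}" "b \<inter> d = {}"
    using large_if_classes[OF q] that ne by (simp add: classes_def meetings_def meets_def)
  ultimately show ?thesis by blast
qed

text \<open>The points \<open>ab\<close>, \<open>bc\<close>, \<open>cd\<close> take everything
  except possibly the \<open>F\<close> class \<open>ac|bd\<close>.\<close>

lemma case_path:
  assumes q: "quad a b c d"
    and ne: "E a b c d \<noteq> {}" "E b c a d \<noteq> {}" "E c d a b \<noteq> {}"
    and em: "E a c b d = {}" "E a d b c = {}" "E b d a c = {}"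
  shows "hit 3 \<or> 4 * r + 4 \<le> card P + card L"
proof -
  note Q = quad_perms[OF q]
  obtain p where p: "p \<in> P" "p \<in> a" "p \<in> b" "\<forall>l \<in> E a b c d. p \<in> l" "\<forall>l \<in> F a b c d. p \<in> l"
    using meet_point[OF Q(1) E_meet[OF ne(1)]] .
  obtain s where s: "s \<in> P" "s \<in> b" "s \<in> c" "\<forall>l \<in> E b c a d. s \<in> l" "\<forall>l \<in> F b c a d. s \<in> l"
    using meet_point[OF Q(9) E_meet[OF ne(2)]] .
  obtain t where t: "t \<in> P" "t \<in> c" "t \<in> d" "\<forall>l \<in> E c d a b. t \<in> l" "\<forall>l \<in> F c d a b. t \<in> l"
    using meet_point[OF Q(17) E_meet[OF ne(3)]] .
  have "hit 3" if "F a c b d = {}"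
    using p s t em that by (intro hit3I[OF q, of p s t]) (simp_all add: F_swap(3)[of b c a d])
  moreover have "4 * r + 4 \<le> card P + card L" if f: "F a c b d \<noteq> {}"
  proof -
    \<comment> \<open>With four nonempty classes this is what \<open>large_if_F\<close> needs; the
      general bound \<open>r + 3\<close> is too weak by one.\<close>
    have "meetings a b c d \<le> r + 2"
    proof (cases "a \<inter> d = {}")
      case True
      then have "meetings a b c d \<le> 5"
        unfolding meetings_def using meets_le_1[of a b] meets_le_1[of a c]
          meets_le_1[of b c] meets_le_1[of b d] meets_le_1[of c d] by (simp add: meets_def)
      \<comment> \<open>For \<open>r = 2\<close> the bound \<open>2 * r\<close> gives 4; for larger
        \<open>r\<close> the bound 5 is enough.\<close>
      then show ?thesis using meetings_le(1)[OF q] by linarith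
    next
      case False
      have ne': "E c b a d \<noteq> {}" using ne by (simp add: swaps)
      \<comment> \<open>\<open>a\<close> now meets \<open>b\<close>, \<open>c\<close> and
        \<open>d\<close> and also contains the triangle point, which lies on none of them, so
        \<open>4 \<le> r\<close>.\<close>
      obtain u where u: "u \<in> a" "\<forall>l \<in> E c b a d \<union> E c d a b \<union> E b d a c. u \<in> l"
        using triangle_point[OF Q(3) ne' ne(3)] .
      then obtain e where "e \<in> E b c a d" "u \<in> e" using ne(2) by (auto simp: swaps)
      then have "u \<notin> b" "u \<notin> c" "u \<notin> d" using triangle_point_off[OF q _ u(1)] by blast+
      then have "4 \<le> r"
        using four_points[OF q _ _ _ u(1)] E_meet[OF ne(1)] F_meet[OF f] False by blast
      then show ?thesis using meetings_le_6[of a b c d] by linarith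
    qed
    then show ?thesis using large_if_F[OF q] f ne by (simp add: classes_def)
  qed
  ultimately show ?thesis by blast
qed

text \<open>The points \<open>ab\<close> and \<open>cd\<close> leave only the \<open>F\<close>
  classes \<open>ac|bd\<close> and \<open>ad|bc\<close>, each with at most one line. A third point
  suffices unless both lines exist and are disjoint.\<close>

lemma case_matching:
  assumes q: "quad a b c d" and ne: "E a b c d \<noteq> {}" "E c d a b \<noteq> {}"
    and em: "E a c b d = {}" "E a d b c = {}" "E b c a d = {}" "E b d a c = {}"
  shows "hit 3 \<or> 4 * r + 4 \<le> card P + card L"
proof -
  note Q = quad_perms[OF q]
  obtain p where p: "p \<in> P" "p \<in> a" "p \<in> b" "\<forall>l \<in> E a b c d. p \<in> l" "\<forall>l \<in> F a b c d. p \<in> l"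
    using meet_point[OF Q(1) E_meet[OF ne(1)]] .
  obtain t where t: "t \<in> P" "t \<in> c" "t \<in> d" "\<forall>l \<in> E c d a b. t \<in> l" "\<forall>l \<in> F c d a b. t \<in> l"
    using meet_point[OF Q(17) E_meet[OF ne(2)]] .
  have third: "hit 3" if "x \<in> P" "\<forall>l \<in> F a c b d. x \<in> l" "\<forall>l \<in> F a d b c. x \<in> l" for x
    using p t em that by (intro hit3I[OF q, of p t x]) simp_all
  show ?thesis
  proof (cases "F a c b d = {} \<or> F a d b c = {}")
    case True
    obtain s where s: "s \<in> P" "\<forall>l \<in> F a c b d. s \<in> l" using spoke_point[OF Q(3)] by metis
    obtain s' where s': "s' \<in> P" "\<forall>l \<in> F a d b c. s' \<in> l" using spoke_point[OF Q(5)] by metis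
    show ?thesis using True third[OF s] third[OF s'(1) _ s'(2)] by blast
  next
    case False
    then obtain f f' where f: "f \<in> F a c b d" "f' \<in> F a d b c" by blast
    note fp = F_props[OF Q(3) f(1)] and fp' = F_props[OF Q(5) f(2)]
    show ?thesis
    proof (cases "f \<inter> f' = {}")
      case False
      then obtain x where x: "x \<in> f" "x \<in> f'" by blast
      have "hit 3"
        using third[OF in_P[OF fp(1) x(1)]] F_unique[OF Q(3) f(1)] F_unique[OF Q(5) f(2)] x by blast
      then show ?thesis ..
    next
      case True
      let ?U = "a \<union> b \<union> c \<union> d"
      have U: "a \<union> c \<union> b \<union> d = ?U" "a \<union> d \<union> b \<union> c = ?U" by auto
      have "card (f - ?U \<union> (f' - ?U)) = card (f - ?U) + card (f' - ?U)"
        using True finite_line[OF fp(1)] finite_line[OF fp'(1)] by (intro card_Un_disjoint) auto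
      moreover have "4 * r + card (f - ?U \<union> (f' - ?U)) \<le> card P + meetings a b c d"
        using line_subset[OF fp(1)] line_subset[OF fp'(1)] by (intro card_P_ge[OF q]) auto
      moreover have "r \<le> card (f - ?U) + 2" "r \<le> card (f' - ?U) + 2"
        using F_outside[OF Q(3) f(1)] F_outside[OF Q(5) f(2)] by (simp_all add: U)
      moreover have "4 \<le> classes a b c d" using ne f by (auto simp: classes_def)
      \<comment> \<open>The disjoint lines add \<open>2 * (r - 2)\<close> points and there are four
        classes, so the total is at least \<open>6 * r + 4\<close> minus the number of meeting
        pairs, which is at most \<open>2 * r\<close>.\<close>
      ultimately show ?thesis
        using card_L_ge[OF q] meetings_le[OF q] meetings_le_6[of a b c d] by linarith
    qed
  qed
qed

text \<open>\<open>hit_star\<close> settles the graphs all of whose edges share a vertex. Up to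
  relabelling, the other graphs on four vertices are the seven treated above: triangle, paw,
  complete graph minus an edge, complete graph, four-cycle, path and perfect matching.\<close>

lemma hit_3_or_large:
  assumes q: "quad a b c d" shows "hit 3 \<or> 4 * r + 4 \<le> card P + card L"
proof -
  note Q = quad_perms[OF q]
  note S = class_perms[where a = a and b = b and c = c and d = d]
  have star: "E b c a d \<noteq> {} \<or> E b d a c \<noteq> {} \<or> E c d a b \<noteq> {}"
    "E a c b d \<noteq> {} \<or> E a d b c \<noteq> {} \<or> E c d a b \<noteq> {}"
    "E a b c d \<noteq> {} \<or> E a d b c \<noteq> {} \<or> E b d a c \<noteq> {}"
    "E a b c d \<noteq> {} \<or> E a c b d \<noteq> {} \<or> E b c a d \<noteq> {}" if "\<not> hit 3"
    using hit_star[OF Q(1)] hit_star[OF Q(7)] hit_star[OF Q(13)] hit_star[OF Q(19)] that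
    unfolding S by blast+
  show ?thesis
    using star Q[THEN case_triangle] Q[THEN case_paw] Q[THEN case_five] Q[THEN case_six]
      Q[THEN case_cycle] Q[THEN case_path] Q[THEN case_matching]
    unfolding S by sat
qed

section \<open>Transversals of size two\<close>

text \<open>The \<open>ab\<close> point takes \<open>a\<close>, \<open>b\<close> and every remaining
  line, the \<open>cd\<close> point takes \<open>c\<close> and \<open>d\<close>.\<close>

lemma hit_2_one_class:
  assumes q: "quad a b c d" and m: "a \<inter> b \<noteq> {}" "c \<inter> d \<noteq> {}"
    and em: "E a c b d = {}" "E a d b c = {}" "E b c a d = {}" "E b d a c = {}" "E c d a b = {}"
      "F a c b d = {}" "F a d b c = {}"
  shows "hit 2"
proof -
  obtain p where p: "p \<in> P" "p \<in> a" "p \<in> b" "\<forall>l \<in> E a b c d. p \<in> l" "\<forall>l \<in> F a b c d. p \<in> l"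
    using meet_point[OF q m(1)] .
  obtain s where s: "s \<in> P" "s \<in> c" "s \<in> d"
    using meet_point[OF quad_perms(17)[OF q] m(2)] by metis
  have "{p, s} \<inter> l \<noteq> {} \<longleftrightarrow> p \<in> l \<or> s \<in> l" for l by blast
  then show ?thesis
    using p s em by (intro hitI[OF q, of "{p, s}"]) (simp_all only:, auto simp: card_insert_if)
qed

lemma classes_pos:
  assumes q: "quad a b c d" shows "1 \<le> classes a b c d"
proof -
  obtain l where l: "l \<in> L" "l \<notin> {a, b, c, d}" using exists_extra .
  show ?thesis using line_cases[OF q l(1)] l(2) by (auto simp: classes_def)
qed

lemma hit_2_or_large:
  assumes q: "quad a b c d" shows "hit 2 \<or> 3 * r + 3 \<le> card P + card L"
proof (cases "3 * r + 3 \<le> card P + card L")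
  case False
  note Q = quad_perms[OF q]
  have small: "classes a b c d + r + 1 < meetings a b c d"
    using False card_P_ge[OF q, of "{}"] card_L_ge[OF q] by simp
  \<comment> \<open>At least one class is nonempty, so at least \<open>r + 3\<close> pairs meet;
    this number is at most \<open>2 * r\<close> and at most 6, which leaves only
    \<open>r = 3\<close>.\<close>
  then have r3: "r = 3" and k6: "meetings a b c d = 6" and one: "classes a b c d = 1"
    using classes_pos[OF q] meetings_le(1)[OF q] meetings_le_6[of a b c d] by linarith+
  \<comment> \<open>An \<open>F\<close> line would give at least \<open>15 - 6 - 2 = 7\<close>
    points, which with five lines reaches \<open>3 * r + 3 = 12\<close>.\<close>
  have F: "F a b c d = {}" "F a c b d = {}" "F a d b c = {}"
    using False card_P_ge_F[OF q] card_L_ge[OF q] r3 k6 one by fastforce+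
  have m: "a \<inter> b \<noteq> {}" "a \<inter> c \<noteq> {}" "a \<inter> d \<noteq> {}" "b \<inter> c \<noteq> {}" "b \<inter> d \<noteq> {}" "c \<inter> d \<noteq> {}"
    using k6 unfolding meetings_def meets_def of_bool_def by (simp_all split: if_splits)
  note S = class_perms[where a = a and b = b and c = c and d = d]
  have U: "(E a b c d = {} \<or> E a c b d = {}) \<and> (E a b c d = {} \<or> E a d b c = {}) \<and>
      (E a b c d = {} \<or> E b c a d = {}) \<and> (E a b c d = {} \<or> E b d a c = {}) \<and>
      (E a b c d = {} \<or> E c d a b = {}) \<and> (E a c b d = {} \<or> E a d b c = {}) \<and>
      (E a c b d = {} \<or> E b c a d = {}) \<and> (E a c b d = {} \<or> E b d a c = {}) \<and>
      (E a c b d = {} \<or> E c d a b = {}) \<and> (E a d b c = {} \<or> E b c a d = {}) \<and>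
      (E a d b c = {} \<or> E b d a c = {}) \<and> (E a d b c = {} \<or> E c d a b = {}) \<and>
      (E b c a d = {} \<or> E b d a c = {}) \<and> (E b c a d = {} \<or> E c d a b = {}) \<and>
      (E b d a c = {} \<or> E c d a b = {})"
    by (intro conjI; rule ccontr; insert one[unfolded classes_def]; simp)
  have "hit 2"
    using hit_2_one_class[OF Q(1) m(1,6)] hit_2_one_class[OF Q(3) m(2,5)]
      hit_2_one_class[OF Q(5) m(3,4)] hit_2_one_class[OF Q(9) m(4,3)]
      hit_2_one_class[OF Q(11) m(5,2)] hit_2_one_class[OF Q(17) m(6,1)] U F
    unfolding S by argo
  then show ?thesis ..
qed blast

text \<open>At least \<open>4 * r - 6\<close> points and five lines.\<close>

lemma size_ge:
  assumes q: "quad a b c d" shows "2 * r + 2 \<le> card P + card L"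
  using card_P_ge[OF q, of "{}"] meetings_le_6[of a b c d] card_L r_ge_2 by simp

end

section \<open>From the 2-packing number to the setting, and the final bound\<close>

lemma packing4_system_and_quad:
  assumes r: "2 \<le> r" and lin: "linear_system P L" and uni: "uniform_system r L"
    and gt: "two_packing_number P L < card L" and nu: "two_packing_number P L = 4"
  shows "packing4_system P L r" and "\<exists>a b c d. packing4_system.quad L a b c d"
proof -
  let ?S = "{card R |R. two_packing P L R}"
  have finP: "finite P" and sub: "\<And>l. l \<in> L \<Longrightarrow> l \<subseteq> P"
    and int: "\<And>l l'. l \<in> L \<Longrightarrow> l' \<in> L \<Longrightarrow> l \<noteq> l' \<Longrightarrow> card (l \<inter> l') \<le> 1"
    using lin by (auto simp: linear_system_def)
  \<comment> \<open>An infinite \<open>L\<close> would have \<open>card L = 0\<close>, contradicting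
    the strict inequality.\<close>
  have finL: "finite L" using gt by (metis card.infinite not_less0)
  have "?S \<subseteq> card ` Pow L" by (auto simp: two_packing_def)
  then have finS: "finite ?S" using finL by (meson finite_Pow_iff finite_imageI finite_subset)
  have packing: "two_packing P L R \<longleftrightarrow> R \<subseteq> L \<and>
      (\<forall>x\<in>R. \<forall>y\<in>R. \<forall>z\<in>R. x \<noteq> y \<and> x \<noteq> z \<and> y \<noteq> z \<longrightarrow> \<not> conc x y z)" for R
  proof (cases "R \<subseteq> L")
    case True
    have "(\<exists>p\<in>P. p \<in> x \<and> p \<in> y \<and> p \<in> z) \<longleftrightarrow> conc x y z" if "x \<in> R" for x y z
      using sub[of x] True that by (auto simp: conc_def)
    then show ?thesis by (simp add: two_packing_def)
  qed (simp add: two_packing_def)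
  have not_packing: "\<exists>x y z. x \<in> R \<and> y \<in> R \<and> z \<in> R \<and> conc x y z \<and> x \<noteq> y \<and> x \<noteq> z \<and> y \<noteq> z"
    if "R \<subseteq> L" "\<not> two_packing P L R" for R
    using that unfolding packing by blast
  have small: "card R \<le> 4" if "two_packing P L R" for R
    using Max_ge[OF finS, of "card R"] that nu unfolding two_packing_number_def by auto
  show sys: "packing4_system P L r"
  proof
    show "finite P" "2 \<le> r" "5 \<le> card L" using finP r gt nu by simp_all
    show "l \<subseteq> P" "card l = r" if "l \<in> L" for l using sub uni that by (simp_all add: uniform_system_def)
    show "p = q" if "l \<in> L" "l' \<in> L" "l \<noteq> l'" "p \<in> l" "p \<in> l'" "q \<in> l" "q \<in> l'" for l l' p q
    proof (rule ccontr)
      assume "p \<noteq> q"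
      then have "card {p, q} = 2" by simp
      moreover have "finite (l \<inter> l')" using sub[OF that(1)] finP finite_subset by blast
      ultimately have "2 \<le> card (l \<inter> l')" using that card_mono[of "l \<inter> l'" "{p, q}"] by auto
      then show False using int that by fastforce
    qed
    show "conc u v w \<or> conc u v x \<or> conc u v y \<or> conc u w x \<or> conc u w y \<or> conc u x y \<or>
        conc v w x \<or> conc v w y \<or> conc v x y \<or> conc w x y"
      if R: "{u, v, w, x, y} \<subseteq> L" and dist: "distinct [u, v, w, x, y]" for u v w x y
    proof (rule ccontr)
      assume no: "\<not> ?thesis"
      have "card {u, v, w, x, y} = 5" using dist by simp
      then have "\<not> two_packing P L {u, v, w, x, y}" using small by fastforce
      then obtain x' y' z' where "x' \<in> {u, v, w, x, y}" "y' \<in> {u, v, w, x, y}" "z' \<in> {u, v, w, x, y}"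
        "conc x' y' z'" "x' \<noteq> y'" "x' \<noteq> z'" "y' \<noteq> z'"
        using not_packing[OF R] by metis
      moreover have "\<not> conc u v w" "\<not> conc u v x" "\<not> conc u v y" "\<not> conc u w x" "\<not> conc u w y"
        "\<not> conc u x y" "\<not> conc v w x" "\<not> conc v w y" "\<not> conc v x y" "\<not> conc w x y" using no by blast+
      \<comment> \<open>Each choice of three distinct lines among the five is, up to order, one of
        the ten excluded triples.\<close>
      ultimately show False
        unfolding insert_iff empty_iff by (elim disjE; simp add: conc_swap)
    qed
  qed
  then interpret packing4_system P L r .
  have "two_packing P L {}" by (simp add: two_packing_def)
  \<comment> \<open>The maximum is attained, the empty packing making the set nonempty; this yields
    the four lines of \<open>quad\<close>.\<close>
  then have "Max ?S \<in> ?S" using finS by (intro Max_in) auto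
  then obtain R where R: "two_packing P L R" "card R = 4"
    using nu unfolding two_packing_number_def by auto
  then obtain a b c d where "R = {a, b, c, d}" "distinct [a, b, c, d]"
    using card_eq_SucD by (auto simp: numeral_eq_Suc card_Suc_eq)
  then have "quad a b c d" using R(1) unfolding packing quad_def by auto
  then show "\<exists>a b c d. quad a b c d" by blast
qed

theorem theorem2p11:
  fixes P :: "'a set" and L :: "'a set set" and r :: nat
  assumes "r \<ge> 2"
    and "linear_system P L"
    and "uniform_system r L"
    and "card L > two_packing_number P L"
    and "two_packing_number P L = 4"
  shows "real (transversal_number P L) \<le> (real (card P) + real (card L)) / (real r + 1)"
proof -
  interpret packing4_system P L r by (rule packing4_system_and_quad(1)[OF assms])
  obtain a b c d where q: "quad a b c d" using packing4_system_and_quad(2)[OF assms] by blast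
  have "{card T |T. transversal P L T} \<subseteq> card ` Pow P" by (auto simp: transversal_def)
  then have fin: "finite {card T |T. transversal P L T}"
    using finite_P by (meson finite_Pow_iff finite_imageI finite_subset)
  have le: "transversal_number P L \<le> k" if h: "hit k" for k
  proof -
    obtain T where T: "transversal P L T" "card T \<le> k"
      using h by (auto simp: hit_def transversal_def)
    then show ?thesis
      using Min_le[OF fin, of "card T"] unfolding transversal_number_def by force
  qed
  \<comment> \<open>Take \<open>k = 4\<close> if the total reaches \<open>4 * r + 4\<close>.
    Otherwise three points suffice, and \<open>k = 3\<close> works if the total reaches
    \<open>3 * r + 3\<close>; failing that, two points suffice and \<open>size_ge\<close> covers
    \<open>k = 2\<close>.\<close>
  have "\<exists>k. hit k \<and> k * (r + 1) \<le> card P + card L"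
  proof -
    consider "4 * r + 4 \<le> card P + card L" | "hit 3" "3 * r + 3 \<le> card P + card L" | "hit 2"
      using hit_3_or_large[OF q] hit_2_or_large[OF q] by blast
    then show ?thesis
    proof cases
      case 1 then show ?thesis using hit_4[OF q] by (intro exI[of _ 4]) simp
    next
      case 2 then show ?thesis by (intro exI[of _ 3]) simp
    next
      case 3 then show ?thesis using size_ge[OF q] by (intro exI[of _ 2]) simp
    qed
  qed
  then obtain k where k: "hit k" "k * (r + 1) \<le> card P + card L" by blast
  have "transversal_number P L * (r + 1) \<le> card P + card L"
    using mult_le_mono1[OF le[OF k(1)], of "r + 1"] k(2) by linarith
  then have "real (transversal_number P L * (r + 1)) \<le> real (card P + card L)"
    by (simp only: of_nat_le_iff)
  then show ?thesis by (simp add: pos_le_divide_eq algebra_simps)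
qed

end
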